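(* Let $e=(e_n)$ denote the canonical basis for $\ell_p$, $1\leq p<\infty$, or for $c_0$. Then $\mathcal{JS}_{e,\omega_1}$ is a norm-closed operator ideal.
   Context: A sequence $(x_n)$ in a Banach space dominates a sequence $(y_n)$ in a Banach space, written $(x_n)\geq(y_n)$ or $(y_n)\leq(x_n)$, if there is $C\in[1,\infty)$ with $\|\sum a_ny_n\|\leq C\|\sum a_nx_n\|$ for all $(a_n)\in c_{00}$ (finitely supported scalar sequences). Let $e=(e_n)$ be a normalized basis of a Banach space $E$. For Banach spaces $X,Y$, $\mathcal{JS}_{e,\omega_1}(X,Y)$ is the set of all continuous linear operators $T\in\mathcal{L}(X,Y)$ such that for every normalized basic sequence $(x_n)$ in $X$ satisfying $(x_n)\leq(e_n)$, the sequence $(Tx_n)$ fails to dominate $(e_n)$. The class $\mathcal{JS}_{e,\omega_1}$ is the union of these components over all $X,Y$. A class $\mathcal{J}$ of continuous linear operators between Banach spaces, with components $\mathcal{J}(X,Y)=\mathcal{J}\cap\mathcal{L}(X,Y)$, is an operator ideal if $BTA\in\mathcal{J}$ whenever $T\in\mathcal{J}(X,Y)$, $A\in\mathcal{L}(W,X)$, $B\in\mathcal{L}(Y,Z)$ for Banach spaces $W,X,Y,Z$, and every component $\mathcal{J}(X,Y)$ is a linear subspace of $\mathcal{L}(X,Y)$ containing all finite-rank operators. It is norm-closed if every component $\mathcal{J}(X,Y)$ is norm-closed in $\mathcal{L}(X,Y)$. *)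

theory Defs
  imports "HOL-Analysis.Analysis" "HOL-Library.Function_Algebras"
begin

text \<open>
  Scalars range over a \<^class>\<open>real_normed_field\<close>, which by the Gelfand--Mazur theorem is the real or
  the complex field.  A Banach space over such a field is a type of class \<^class>\<open>banach\<close> with a
  scalar multiplication \<open>s\<close> that is compatible with the norm and extends the real one; over
  the reals the only choice is \<open>s = scaleR\<close>.
\<close>

locale banach_over = vector_space s
  for s :: "'k::real_normed_field \<Rightarrow> 'x::banach \<Rightarrow> 'x" +
  assumes norm_scale: "norm (s c x) = norm c * norm x"
    and scale_of_real: "s (of_real r) x = r *\<^sub>R x"

definition bounded_ops ::
  "('k::real_normed_field \<Rightarrow> 'x::banach \<Rightarrow> 'x) \<Rightarrow> ('k \<Rightarrow> 'y::banach \<Rightarrow> 'y) \<Rightarrow> ('x \<Rightarrow>\<^sub>L 'y) set" where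
  "bounded_ops sX sY = {T. \<forall>c x. blinfun_apply T (sX c x) = sY c (blinfun_apply T x)}"

definition op_scale ::
  "('k::real_normed_field \<Rightarrow> 'y::banach \<Rightarrow> 'y) \<Rightarrow> 'k \<Rightarrow> ('x::banach \<Rightarrow>\<^sub>L 'y) \<Rightarrow> ('x \<Rightarrow>\<^sub>L 'y)" where
  "op_scale sY c T = Blinfun (\<lambda>x. sY c (blinfun_apply T x))"

definition finite_rank ::
  "('k::real_normed_field \<Rightarrow> 'y::banach \<Rightarrow> 'y) \<Rightarrow> ('x::banach \<Rightarrow>\<^sub>L 'y) \<Rightarrow> bool" where
  "finite_rank sY T \<longleftrightarrow>
     (\<exists>B. finite B \<and> range (blinfun_apply T) \<subseteq> module.span sY B)"

text \<open>
  In \<open>dominates nx sx x ny sy y\<close> the sequence \<open>x\<close> lives in a space with norm \<open>nx\<close> and scalar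
  multiplication \<open>sx\<close>, and \<open>y\<close> in one with \<open>ny\<close> and \<open>sy\<close>.  The norms are explicit because the
  exponent of an \<open>\<ell>\<^sub>p\<close> space cannot be a parameter of a type.
\<close>

definition dominates ::
  "('a::comm_monoid_add \<Rightarrow> real) \<Rightarrow> ('k::real_normed_field \<Rightarrow> 'a \<Rightarrow> 'a) \<Rightarrow> (nat \<Rightarrow> 'a) \<Rightarrow>
   ('b::comm_monoid_add \<Rightarrow> real) \<Rightarrow> ('k \<Rightarrow> 'b \<Rightarrow> 'b) \<Rightarrow> (nat \<Rightarrow> 'b) \<Rightarrow> bool" where
  "dominates nx sx x ny sy y \<longleftrightarrow>
     (\<exists>C\<ge>1. \<forall>a. finite {n. a n \<noteq> 0} \<longrightarrow>
        ny (\<Sum>n | a n \<noteq> 0. sy (a n) (y n)) \<le> C * nx (\<Sum>n | a n \<noteq> 0. sx (a n) (x n)))"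

text \<open>A basic sequence is a Schauder basis of its closed linear span.\<close>

definition basic_sequence ::
  "('k::real_normed_field \<Rightarrow> 'x::banach \<Rightarrow> 'x) \<Rightarrow> (nat \<Rightarrow> 'x) \<Rightarrow> bool" where
  "basic_sequence s x \<longleftrightarrow>
     (\<forall>v \<in> closure (module.span s (range x)). \<exists>!a. (\<lambda>n. s (a n) (x n)) sums v)"

definition JS ::
  "('e::comm_monoid_add \<Rightarrow> real) \<Rightarrow> ('k::real_normed_field \<Rightarrow> 'e \<Rightarrow> 'e) \<Rightarrow> (nat \<Rightarrow> 'e) \<Rightarrow>
   ('k \<Rightarrow> 'x::banach \<Rightarrow> 'x) \<Rightarrow> ('k \<Rightarrow> 'y::banach \<Rightarrow> 'y) \<Rightarrow> ('x \<Rightarrow>\<^sub>L 'y) set" where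
  "JS nE sE e sX sY =
     {T \<in> bounded_ops sX sY.
        \<forall>x. (\<forall>n. norm (x n) = 1) \<and> basic_sequence sX x \<and> dominates nE sE e norm sX x \<longrightarrow>
            \<not> dominates norm sY (\<lambda>n. blinfun_apply T (x n)) nE sE e}"

text \<open>
  The spaces \<open>\<ell>\<^sub>p\<close> and \<open>c\<^sub>0\<close> consist of functions \<^typ>\<open>nat \<Rightarrow> 'k\<close>, with pointwise addition from
  \<^theory>\<open>HOL-Library.Function_Algebras\<close>.  Only norms of finite linear combinations of the
  canonical basis occur in \<^const>\<open>JS\<close>, so the values of the norms below at sequences
  outside the respective space are irrelevant.
\<close>

definition seq_scale :: "'k::real_normed_field \<Rightarrow> (nat \<Rightarrow> 'k) \<Rightarrow> (nat \<Rightarrow> 'k)" where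
  "seq_scale c f = (\<lambda>k. c * f k)"

definition canonical_basis :: "nat \<Rightarrow> (nat \<Rightarrow> 'k::real_normed_field)" where
  "canonical_basis n = (\<lambda>k. if k = n then 1 else 0)"

definition lp_norm :: "real \<Rightarrow> (nat \<Rightarrow> 'k::real_normed_field) \<Rightarrow> real" where
  "lp_norm p f = (\<Sum>k. norm (f k) powr p) powr (1 / p)"

definition c0_norm :: "(nat \<Rightarrow> 'k::real_normed_field) \<Rightarrow> real" where
  "c0_norm f = (SUP k. norm (f k))"

lemma (in banach_over) bounded_linear_scale: "bounded_linear (s c)"
proof (rule bounded_linear_intro[where K = "norm c"])
  fix r x
  show "s c (r *\<^sub>R x) = r *\<^sub>R s c x"
    by (simp flip: scale_of_real add: mult.commute)
qed (simp_all add: scale_right_distrib norm_scale mult.commute)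

lemma (in banach_over) op_scale_apply:
  "blinfun_apply (op_scale s c T) x = s c (blinfun_apply T x)"
  unfolding op_scale_def
  by (subst bounded_linear_Blinfun_apply)
     (auto intro: bounded_linear_compose[OF bounded_linear_scale] blinfun.bounded_linear_right)

lemma (in banach_over) module_op_scale: "module (op_scale s)"
  by unfold_locales
     (auto intro!: blinfun_eqI simp: op_scale_apply blinfun.add_left
        scale_right_distrib scale_left_distrib)

end

theory Submission
  imports Defs
begin

text \<open>
  An operator \<open>T\<close> lies outside \<open>JS\<close> iff it fixes a copy of the basis: there are vectors
  \<open>x n\<close>, neither normalized nor basic a priori, such that \<open>x\<close> is dominated by \<open>e\<close> and
  \<open>T x\<close> dominates \<open>e\<close>.  Normalization is harmless because \<open>e\<close> is unconditional, and basicness is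
  automatic because \<open>x\<close> is then equivalent to \<open>e\<close>.  Fixing a copy is stable under small
  perturbations and passes from \<open>B T A\<close> to \<open>T\<close>, and a finite-rank operator cannot do it.  If
  \<open>S + T\<close> fixes \<open>x\<close>, then either \<open>S\<close> is bounded below on the span of a tail of \<open>x\<close>, or there are
  disjoint blocks of \<open>x\<close>, again equivalent to \<open>e\<close>, on which \<open>S\<close> is so small that \<open>T\<close> fixes them.
\<close>

section \<open>Finitely supported coefficient sequences and disjoint blocks\<close>

abbreviation finsupp :: "(nat \<Rightarrow> 'k::zero) \<Rightarrow> bool" where
  "finsupp a \<equiv> finite {n. a n \<noteq> 0}"

lemma finsupp_diff:
  fixes a b :: "nat \<Rightarrow> 'k::group_add"
  assumes "finsupp a" "finsupp b" shows "finsupp (\<lambda>n. a n - b n)"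
  by (rule finite_subset[OF _ finite_UnI[OF assms]]) auto

lemma finsupp_add:
  fixes a b :: "nat \<Rightarrow> 'k::monoid_add"
  assumes "finsupp a" "finsupp b" shows "finsupp (\<lambda>n. a n + b n)"
  by (rule finite_subset[OF _ finite_UnI[OF assms]]) auto

lemma finsupp_mult:
  fixes a :: "nat \<Rightarrow> 'k::mult_zero"
  assumes "finsupp a" shows "finsupp (\<lambda>n. c n * a n)"
  by (rule finite_subset[OF _ assms]) auto

lemma supp_block_subset:
  fixes b :: "nat \<Rightarrow> 'k::semiring_0"
  shows "{n. (\<Sum>k\<in>K. b k * c k n) \<noteq> 0} \<subseteq> (\<Union>k\<in>K. {n. c k n \<noteq> 0})"
proof (rule subsetI, rule ccontr)
  fix n assume n: "n \<in> {n. (\<Sum>k\<in>K. b k * c k n) \<noteq> 0}" "n \<notin> (\<Union>k\<in>K. {n. c k n \<noteq> 0})"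
  then have "(\<Sum>k\<in>K. b k * c k n) = 0" by (intro sum.neutral) auto
  with n(1) show False by simp
qed

lemma finsupp_block:
  fixes b :: "nat \<Rightarrow> 'k::semiring_0"
  assumes "finite K" "\<And>k. finsupp (c k)"
  shows "finsupp (\<lambda>n. \<Sum>k\<in>K. b k * c k n)"
  by (rule finite_subset[OF supp_block_subset]) (use assms in auto)

text \<open>A gliding hump: witnesses are chosen one after another, each starting beyond the
  supports of all earlier ones. This is possible because the hypothesis offers a witness for every
  starting index \<open>m\<close>.\<close>

lemma disjoint_blocks:
  fixes Q :: "nat \<Rightarrow> (nat \<Rightarrow> 'k::zero) \<Rightarrow> bool"
  assumes "\<And>m k. \<exists>a. finsupp a \<and> (\<forall>n<m. a n = 0) \<and> Q k a"
  shows "\<exists>c. (\<forall>k. finsupp (c k) \<and> Q k (c k)) \<and>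
    (\<forall>j k n. c j n \<noteq> 0 \<longrightarrow> c k n \<noteq> 0 \<longrightarrow> j = k)"
proof -
  define g where "g m k = (SOME a. finsupp a \<and> (\<forall>n<m. a n = 0) \<and> Q k a)" for m k
  have g0: "finsupp (g m k) \<and> (\<forall>n<m. g m k n = 0) \<and> Q k (g m k)" for m k
    unfolding g_def by (rule someI_ex[OF assms])
  have g: "finsupp (g m k)" "Q k (g m k)" "n < m \<Longrightarrow> g m k n = 0" for m k n
    using g0[of m k] by simp_all
  define l where "l m k = (SOME l. {n. g m k n \<noteq> 0} \<subseteq> {..<l})" for m k
  have l: "{n. g m k n \<noteq> 0} \<subseteq> {..<l m k}" for m k
    unfolding l_def by (rule someI_ex) (rule finite_nat_bounded[OF g(1)])
  \<comment> \<open>\<open>M k\<close> is where block \<open>k\<close> may start. The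
    \<open>max\<close> keeps \<open>M\<close> nondecreasing even if block \<open>k\<close> is zero
    and its bound \<open>l (M k) k\<close> lies below \<open>M k\<close>.\<close>
  define M where "M = rec_nat 0 (\<lambda>k m. max m (l m k))"
  have M: "M (Suc k) = max (M k) (l (M k) k)" for k by (simp add: M_def)
  have M_mono: "M j \<le> M k" if "j \<le> k" for j k
    by (rule lift_Suc_mono_le[OF _ that]) (simp add: M)
  define c where "c k = g (M k) k" for k
  have supp: "M k \<le> n" "n < M (Suc k)" if "c k n \<noteq> 0" for k n
  proof -
    show "M k \<le> n" using g(3)[of n "M k" k] that unfolding c_def by linarith
    have "n < l (M k) k" using l[of "M k" k] that by (auto simp: c_def)
    then show "n < M (Suc k)" by (simp add: M)
  qed
  have less: "\<not> j < k" if "c j n \<noteq> 0" "c k n \<noteq> 0" for j k n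
    using M_mono[of "Suc j" k] supp(2)[OF that(1)] supp(1)[OF that(2)] by linarith
  have "j = k" if "c j n \<noteq> 0" "c k n \<noteq> 0" for j k n
    using less[OF that] less[OF that(2,1)] by simp
  moreover have "finsupp (c k)" "Q k (c k)" for k by (simp_all add: c_def g)
  ultimately show ?thesis by (intro exI[of _ c] conjI allI impI)
qed

section \<open>Finite linear combinations\<close>

text \<open>This names the sums in \<open>dominates\<close>. The scalar multiplication is an
  argument so that one constant serves both Banach spaces and \<open>seq_scale\<close>.\<close>

definition lincomb :: "('k::zero \<Rightarrow> 'x \<Rightarrow> 'x) \<Rightarrow> (nat \<Rightarrow> 'k) \<Rightarrow> (nat \<Rightarrow> 'x) \<Rightarrow> 'x::comm_monoid_add" where
  "lincomb s a x = (\<Sum>n | a n \<noteq> 0. s (a n) (x n))"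

text \<open>This lets the norm of a combination of the basis in \<open>dominates\<close> be replaced
  by the norm of the coefficient sequence itself.\<close>

lemma lincomb_canonical_basis:
  fixes a :: "nat \<Rightarrow> 'k::real_normed_field"
  assumes "finsupp a"
  shows "lincomb seq_scale a canonical_basis = a"
proof
  fix k
  have *: "(\<Sum>n\<in>F. f n) k = (\<Sum>n\<in>F. f n k)" for F :: "nat set" and f :: "nat \<Rightarrow> nat \<Rightarrow> 'k"
    by (induction F rule: infinite_finite_induct) auto
  have "lincomb seq_scale a canonical_basis k = (\<Sum>n | a n \<noteq> 0. if k = n then a n else 0)"
    unfolding lincomb_def * by (intro sum.cong) (auto simp: seq_scale_def canonical_basis_def)
  also have "\<dots> = a k" using assms by (simp add: sum.delta)
  finally show "lincomb seq_scale a canonical_basis k = a k" .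
qed

context vector_space
begin

lemma lincomb_eq_sum:
  assumes "finite F" "{n. a n \<noteq> 0} \<subseteq> F"
  shows "lincomb scale a x = (\<Sum>n\<in>F. scale (a n) (x n))"
  unfolding lincomb_def by (rule sum.mono_neutral_left) (use assms in auto)

lemma lincomb_single: "lincomb scale (\<lambda>n. if n = k then c else 0) x = scale c (x k)"
  by (subst lincomb_eq_sum[of "{k}"]) auto

lemma lincomb_restrict: 
  "lincomb scale (\<lambda>n. if n < m then a n else 0) x = (\<Sum>n<m. scale (a n) (x n))"
  by (subst lincomb_eq_sum[of "{..<m}"]) auto

lemma lincomb_add:
  assumes "finsupp a" "finsupp b"
  shows "lincomb scale (\<lambda>n. a n + b n) x = lincomb scale a x + lincomb scale b x"
proof -
  define F where "F = {n. a n \<noteq> 0} \<union> {n. b n \<noteq> 0}"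
  have "finite F" using assms by (simp add: F_def)
  then show ?thesis
    by (subst (1 2 3) lincomb_eq_sum[of F]) (auto simp: F_def scale_left_distrib sum.distrib)
qed

lemma lincomb_mult:
  assumes "finsupp a"
  shows "lincomb scale (\<lambda>n. c * a n) x = scale c (lincomb scale a x)"
  using assms
  by (subst (1 2) lincomb_eq_sum[of "{n. a n \<noteq> 0}"]) (auto simp: scale_sum_right)

lemma lincomb_diff:
  assumes "finsupp a" "finsupp b"
  shows "lincomb scale (\<lambda>n. a n - b n) x = lincomb scale a x - lincomb scale b x"
  using lincomb_add[OF assms(1) finsupp_mult[OF assms(2), of "\<lambda>_. -1"]]
    lincomb_mult[OF assms(2), of "-1"] by simp

text \<open>Estimates for \<open>x\<close> pass to blocks of \<open>x\<close> through this identity.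
  The inner sums are extended to a common finite index set \<open>F\<close>, after which the two
  summations can be exchanged.\<close>

lemma lincomb_lincomb:
  assumes b: "finsupp b" and c: "\<And>k. finsupp (c k)"
  shows "lincomb scale b (\<lambda>k. lincomb scale (c k) x) =
         lincomb scale (\<lambda>n. \<Sum>k | b k \<noteq> 0. b k * c k n) x"
proof -
  define F where "F = (\<Union>k\<in>{k. b k \<noteq> 0}. {n. c k n \<noteq> 0})"
  have F: "finite F" using b c by (auto simp: F_def)
  have supp: "{n. (\<Sum>k | b k \<noteq> 0. b k * c k n) \<noteq> 0} \<subseteq> F"
    unfolding F_def by (rule supp_block_subset)
  have "lincomb scale b (\<lambda>k. lincomb scale (c k) x) =
        (\<Sum>k | b k \<noteq> 0. scale (b k) (\<Sum>n\<in>F. scale (c k n) (x n)))"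
    unfolding lincomb_def[of scale b]
    by (intro sum.cong refl arg_cong[of _ _ "scale _"] lincomb_eq_sum F) (auto simp: F_def)
  also have "\<dots> = (\<Sum>n\<in>F. scale (\<Sum>k | b k \<noteq> 0. b k * c k n) (x n))"
    unfolding scale_sum_right scale_sum_left scale_scale by (rule sum.swap)
  also have "\<dots> = lincomb scale (\<lambda>n. \<Sum>k | b k \<noteq> 0. b k * c k n) x"
    by (rule lincomb_eq_sum[OF F supp, symmetric])
  finally show ?thesis .
qed

lemma span_range_imp_lincomb:
  assumes "v \<in> span (range x)"
  shows "\<exists>a. finsupp a \<and> v = lincomb scale a x"
  using assms
proof (induction rule: span_induct_alt)
  case base
  show ?case by (intro exI[of _ "\<lambda>_. 0"]) (simp add: lincomb_def)
next
  case (step c y v)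
  then obtain k a where k: "y = x k" and a: "finsupp a" "v = lincomb scale a x" by auto
  have single: "finsupp (\<lambda>n. if n = k then c else 0)"
    by (rule finite_subset[of _ "{k}"]) auto
  show ?case
    by (intro exI[of _ "\<lambda>n. (if n = k then c else 0) + a n"])
      (simp only: finsupp_add[OF single a(1)] lincomb_add[OF single a(1)] lincomb_single k a(2) simp_thms)
qed

end

text \<open>Boundedness of \<open>T\<close> turns a lower estimate on the image into one on the
  vector. The summand 1 keeps the new constant positive even for \<open>T = 0\<close>.\<close>

lemma bounded_below_of_image:
  assumes "C > 0" "r \<le> C * norm (blinfun_apply T v)"
  shows "r \<le> C * (norm T + 1) * norm v"
proof -
  have "norm (blinfun_apply T v) \<le> (norm T + 1) * norm v"
    using norm_blinfun[of T v] norm_ge_zero[of v] unfolding distrib_right by linarith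
  from mult_left_mono[OF this, of C] show ?thesis using assms unfolding mult.assoc by linarith
qed

lemma bounded_ops_lincomb:
  assumes "T \<in> bounded_ops sX sY"
  shows "blinfun_apply T (lincomb sX a x) = lincomb sY a (\<lambda>n. blinfun_apply T (x n))"
  using assms by (simp add: lincomb_def bounded_ops_def blinfun.sum_right)

context banach_over
begin

lemma bounded_linear_scale_left: "bounded_linear (\<lambda>c. s c x)"
proof (rule bounded_linear_intro[where K = "norm x"])
  show "s (r *\<^sub>R c) x = r *\<^sub>R s c x" for r c
    by (simp add: scaleR_conv_of_real flip: scale_of_real)
qed (simp_all add: scale_left_distrib norm_scale)

end

text \<open>The only features of the norms of \<open>\<ell>\<^sub>p\<close> and \<open>c\<^sub>0\<close> that matter: the unit vector basis is
  unconditional and isometrically equivalent to each of its normalized disjoint sequences.\<close>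

locale perfectly_homogeneous =
  fixes N :: "(nat \<Rightarrow> 'k::real_normed_field) \<Rightarrow> real"
  assumes mono: "finsupp b \<Longrightarrow> (\<And>n. norm (a n) \<le> norm (b n)) \<Longrightarrow> N a \<le> N b"
    and mult: "finsupp a \<Longrightarrow> N (\<lambda>n. t * a n) = norm t * N a"
    and coord_le: "finsupp a \<Longrightarrow> norm (a n) \<le> N a"
    and basis: "N (canonical_basis n) = 1"
    and disjoint: "finsupp b \<Longrightarrow> (\<And>k. finsupp (c k)) \<Longrightarrow> (\<And>k. N (c k) = 1) \<Longrightarrow>
      (\<And>j k n. c j n \<noteq> 0 \<Longrightarrow> c k n \<noteq> 0 \<Longrightarrow> j = k) \<Longrightarrow>
      N (\<lambda>n. \<Sum>k | b k \<noteq> 0. b k * c k n) = N b"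
begin

lemma nonneg: "finsupp a \<Longrightarrow> 0 \<le> N a"
  using coord_le[of a 0] norm_ge_zero[of "a 0"] by linarith

end

section \<open>The norms of \<open>lp\<close> and \<open>c0\<close> are perfectly
  homogeneous\<close>

lemma lp_norm_finsupp:
  fixes a :: "nat \<Rightarrow> 'k::real_normed_field"
  assumes "finite F" "{n. a n \<noteq> 0} \<subseteq> F"
  shows "lp_norm p a = (\<Sum>n\<in>F. norm (a n) powr p) powr (1 / p)"
  unfolding lp_norm_def by (subst suminf_finite[of F]) (use assms in auto)

lemma disjoint_sum_eq:
  fixes f :: "'i \<Rightarrow> 'a::comm_monoid_add"
  assumes "finite K" "k \<in> K" "\<And>j. j \<in> K \<Longrightarrow> j \<noteq> k \<Longrightarrow> f j = 0"
  shows "sum f K = f k"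
proof -
  have "sum f K = sum f {k}" by (rule sum.mono_neutral_right) (use assms in auto)
  then show ?thesis by simp
qed

text \<open>For the disjointness condition, at most one block is nonzero at each coordinate, so the
  \<open>p\<close>-th power can be taken term by term. Summing over the coordinates first then
  leaves only the \<open>p\<close>-th powers of the coefficients, since each block has norm
  1.\<close>

lemma perfectly_homogeneous_lp_norm:
  assumes p: "p \<ge> 1"
  shows "perfectly_homogeneous (lp_norm p :: (nat \<Rightarrow> 'k::real_normed_field) \<Rightarrow> real)"
proof
  fix a b :: "nat \<Rightarrow> 'k"
  assume b: "finsupp b" and le: "\<And>n. norm (a n) \<le> norm (b n)"
  have sub: "{n. a n \<noteq> 0} \<subseteq> {n. b n \<noteq> 0}" using le by (auto, metis norm_le_zero_iff norm_zero)
  show "lp_norm p a \<le> lp_norm p b"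
    unfolding lp_norm_finsupp[OF b sub] lp_norm_finsupp[OF b subset_refl]
    using p le by (intro powr_mono2 sum_mono sum_nonneg) auto
next
  fix a :: "nat \<Rightarrow> 'k" and c :: 'k
  assume a: "finsupp a"
  have sub: "{n. c * a n \<noteq> 0} \<subseteq> {n. a n \<noteq> 0}" by auto
  show "lp_norm p (\<lambda>n. c * a n) = norm c * lp_norm p a"
    unfolding lp_norm_finsupp[OF a sub] lp_norm_finsupp[OF a subset_refl]
    using p by (simp add: norm_mult powr_mult sum_nonneg powr_powr flip: sum_distrib_left)
next
  fix a :: "nat \<Rightarrow> 'k" and n
  assume a: "finsupp a"
  have F: "finite (insert n {n. a n \<noteq> 0})" using a by simp
  have "norm (a n) = (norm (a n) powr p) powr (1 / p)" using p by (simp add: powr_powr)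
  also have "\<dots> \<le> (\<Sum>n\<in>insert n {n. a n \<noteq> 0}. norm (a n) powr p) powr (1 / p)"
    using p F by (intro powr_mono2 member_le_sum) auto
  also have "\<dots> = lp_norm p a" by (rule lp_norm_finsupp[symmetric, OF F]) auto
  finally show "norm (a n) \<le> lp_norm p a" .
next
  fix n
  show "lp_norm p (canonical_basis n :: nat \<Rightarrow> 'k) = 1"
    by (subst lp_norm_finsupp[of "{n}"]) (auto simp: canonical_basis_def)
next
  fix b :: "nat \<Rightarrow> 'k" and c :: "nat \<Rightarrow> nat \<Rightarrow> 'k"
  assume b: "finsupp b" and c: "\<And>k. finsupp (c k)" and c1: "\<And>k. lp_norm p (c k) = 1"
    and dis: "\<And>j k n. c j n \<noteq> 0 \<Longrightarrow> c k n \<noteq> 0 \<Longrightarrow> j = k"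
  define K F where "K = {k. b k \<noteq> 0}" and "F = (\<Union>k\<in>K. {n. c k n \<noteq> 0})"
  have K: "finite K" and F: "finite F" using b c by (auto simp: K_def F_def)
  have sub: "{n. (\<Sum>k\<in>K. b k * c k n) \<noteq> 0} \<subseteq> F"
    unfolding F_def by (rule supp_block_subset)
  have pw: "norm (\<Sum>k\<in>K. b k * c k n) powr p = (\<Sum>k\<in>K. norm (b k) powr p * norm (c k n) powr p)" for n
  proof (cases "\<exists>k\<in>K. c k n \<noteq> 0")
    case True
    then obtain k where k: "k \<in> K" "c k n \<noteq> 0" by auto
    have z: "c j n = 0" if "j \<noteq> k" for j using dis[of j n k] k that by auto
    show ?thesis
      by (subst (1 2) disjoint_sum_eq[OF K k(1)]) (auto simp: z norm_mult powr_mult)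
  qed simp
  have one: "(\<Sum>n\<in>F. norm (c k n) powr p) = 1" if "k \<in> K" for k
  proof -
    have "(\<Sum>n\<in>F. norm (c k n) powr p) powr (1 / p) = 1"
      using lp_norm_finsupp[OF F, of "c k" p] c1[of k] that by (auto simp: F_def)
    then have "((\<Sum>n\<in>F. norm (c k n) powr p) powr (1 / p)) powr p = 1" by simp
    then show ?thesis using p by (simp add: powr_powr sum_nonneg)
  qed
  have "lp_norm p (\<lambda>n. \<Sum>k\<in>K. b k * c k n) =
        (\<Sum>n\<in>F. \<Sum>k\<in>K. norm (b k) powr p * norm (c k n) powr p) powr (1 / p)"
    unfolding lp_norm_finsupp[OF F sub] pw ..
  also have "(\<Sum>n\<in>F. \<Sum>k\<in>K. norm (b k) powr p * norm (c k n) powr p) = (\<Sum>k\<in>K. norm (b k) powr p)"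
    by (subst sum.swap) (simp add: one flip: sum_distrib_left)
  also have "(\<Sum>k\<in>K. norm (b k) powr p) powr (1 / p) = lp_norm p b"
    using lp_norm_finsupp[OF b subset_refl] by (simp add: K_def)
  finally show "lp_norm p (\<lambda>n. \<Sum>k | b k \<noteq> 0. b k * c k n) = lp_norm p b" by (simp add: K_def)
qed

lemma c0_norm_bdd_above:
  fixes a :: "nat \<Rightarrow> 'k::real_normed_field"
  assumes "finsupp a"
  shows "bdd_above (range (\<lambda>k. norm (a k)))"
proof -
  have "range (\<lambda>k. norm (a k)) \<subseteq> insert 0 ((\<lambda>k. norm (a k)) ` {n. a n \<noteq> 0})" by auto
  then show ?thesis using assms by (meson bdd_above_finite finite_imageI finite_insert finite_subset)
qed

lemma norm_le_c0_norm: "finsupp a \<Longrightarrow> norm (a k) \<le> c0_norm a"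
  unfolding c0_norm_def by (intro cSUP_upper c0_norm_bdd_above) auto

lemma c0_norm_le: "(\<And>k. norm (a k) \<le> B) \<Longrightarrow> c0_norm a \<le> B"
  unfolding c0_norm_def by (intro cSUP_least) auto

text \<open>The supremum is a maximum over the finite support, or zero if the support is empty.
  Lower estimates of \<open>c0_norm\<close> can then be read off at a single coordinate.\<close>

lemma c0_norm_attained:
  fixes a :: "nat \<Rightarrow> 'k::real_normed_field"
  assumes a: "finsupp a"
  obtains n where "c0_norm a = norm (a n)"
proof (cases "{n. a n \<noteq> 0} = {}")
  case True
  then have "c0_norm a = norm (a 0)" by (simp add: c0_norm_def)
  then show ?thesis by (rule that)
next
  case False
  define m where "m = Max ((\<lambda>n. norm (a n)) ` {n. a n \<noteq> 0})"
  have "m \<in> (\<lambda>n. norm (a n)) ` {n. a n \<noteq> 0}" unfolding m_def using a False by (intro Max_in) auto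
  then obtain n where n: "m = norm (a n)" by auto
  have le: "norm (a k) \<le> m" for k
  proof (cases "a k = 0")
    case False
    then show ?thesis unfolding m_def using a by (intro Max_ge) auto
  qed (simp add: n)
  have "c0_norm a = norm (a n)" 
    using c0_norm_le[of a m] le norm_le_c0_norm[OF a, of n] n by (intro antisym) auto
  then show ?thesis by (rule that)
qed

text \<open>For the disjointness condition, each coordinate meets at most one block, whose entries
  have norm at most 1; this bounds the combination by \<open>c0_norm b\<close>. Conversely, block
  \<open>k\<close> attains its norm 1 somewhere, and there the combination has norm
  \<open>norm (b k)\<close>.\<close>

lemma perfectly_homogeneous_c0_norm:
  "perfectly_homogeneous (c0_norm :: (nat \<Rightarrow> 'k::real_normed_field) \<Rightarrow> real)"
proof
  fix a b :: "nat \<Rightarrow> 'k"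
  assume b: "finsupp b" and le: "\<And>n. norm (a n) \<le> norm (b n)"
  show "c0_norm a \<le> c0_norm b"
    by (rule c0_norm_le) (rule order_trans[OF le norm_le_c0_norm[OF b]])
next
  fix a :: "nat \<Rightarrow> 'k" and c :: 'k
  assume a: "finsupp a"
  obtain n where n: "c0_norm a = norm (a n)" using c0_norm_attained[OF a] .
  show "c0_norm (\<lambda>n. c * a n) = norm c * c0_norm a"
  proof (rule antisym)
    show "c0_norm (\<lambda>n. c * a n) \<le> norm c * c0_norm a"
      by (intro c0_norm_le) (simp add: norm_mult mult_left_mono norm_le_c0_norm[OF a])
    show "norm c * c0_norm a \<le> c0_norm (\<lambda>n. c * a n)"
      using norm_le_c0_norm[OF finsupp_mult[OF a, of "\<lambda>_. c"], of n] by (simp add: norm_mult n)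
  qed
next
  show "finsupp a \<Longrightarrow> norm (a n) \<le> c0_norm a" for a :: "nat \<Rightarrow> 'k" and n
    by (rule norm_le_c0_norm)
next
  fix n
  have fin: "finsupp (canonical_basis n :: nat \<Rightarrow> 'k)"
    by (rule finite_subset[of _ "{n}"]) (auto simp: canonical_basis_def)
  show "c0_norm (canonical_basis n :: nat \<Rightarrow> 'k) = 1"
    using norm_le_c0_norm[OF fin, of n]
    by (intro antisym c0_norm_le) (auto simp: canonical_basis_def)
next
  fix b :: "nat \<Rightarrow> 'k" and c :: "nat \<Rightarrow> nat \<Rightarrow> 'k"
  assume b: "finsupp b" and c: "\<And>k. finsupp (c k)" and c1: "\<And>k. c0_norm (c k) = 1"
    and dis: "\<And>j k n. c j n \<noteq> 0 \<Longrightarrow> c k n \<noteq> 0 \<Longrightarrow> j = k"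
  define K where "K = {k. b k \<noteq> 0}"
  have K: "finite K" using b by (simp add: K_def)
  have b_nonneg: "0 \<le> c0_norm b" by (rule order_trans[OF norm_ge_zero norm_le_c0_norm[OF b, of 0]])
  \<comment> \<open>The index \<open>k\<close> may lie outside \<open>K\<close>; then
    \<open>b k = 0\<close> and every other block vanishes at \<open>n\<close>, so both sides are
    zero.\<close>
  have at: "(\<Sum>k\<in>K. b k * c k n) = b k * c k n" if "c k n \<noteq> 0" for k n
  proof -
    have z: "c j n = 0" if "j \<noteq> k" for j using dis[of j n k] \<open>c k n \<noteq> 0\<close> that by blast
    show ?thesis
    proof (cases "k \<in> K")
      case True
      show ?thesis by (rule disjoint_sum_eq[OF K True]) (simp add: z)
    next
      case False
      then have "b j * c j n = 0" if "j \<in> K" for j using z[of j] that by (cases "j = k") auto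
      then have "(\<Sum>k\<in>K. b k * c k n) = 0" by (rule sum.neutral[rule_format])
      then show ?thesis using False by (simp add: K_def)
    qed
  qed
  have fin: "finsupp (\<lambda>n. \<Sum>k\<in>K. b k * c k n)"
    by (rule finsupp_block[OF K c])
  have "c0_norm (\<lambda>n. \<Sum>k\<in>K. b k * c k n) = c0_norm b"
  proof (intro antisym c0_norm_le)
    fix n
    show "norm (\<Sum>k\<in>K. b k * c k n) \<le> c0_norm b"
    proof (cases "\<exists>k. c k n \<noteq> 0")
      case True
      then obtain k where k: "c k n \<noteq> 0" by auto
      have "norm (b k * c k n) \<le> c0_norm b * 1"
        unfolding norm_mult
        by (rule mult_mono[OF norm_le_c0_norm[OF b] _ b_nonneg norm_ge_zero])
          (use norm_le_c0_norm[OF c, of k n] c1[of k] in simp)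
      then show ?thesis using at[OF k] by simp
    next
      case False
      then show ?thesis using b_nonneg by simp
    qed
  next
    fix k
    obtain n where "c0_norm (c k) = norm (c k n)" using c0_norm_attained[OF c] .
    then have n: "norm (c k n) = 1" using c1 by simp
    then have "norm (b k) = norm (\<Sum>k\<in>K. b k * c k n)" 
      by (subst at[of k]) (auto simp: norm_mult)
    also have "\<dots> \<le> c0_norm (\<lambda>n. \<Sum>k\<in>K. b k * c k n)" by (rule norm_le_c0_norm[OF fin])
    finally show "norm (b k) \<le> c0_norm (\<lambda>n. \<Sum>k\<in>K. b k * c k n)" .
  qed
  then show "c0_norm (\<lambda>n. \<Sum>k | b k \<noteq> 0. b k * c k n) = c0_norm b" by (simp add: K_def)
qed

section \<open>Sequences equivalent to the canonical basis are basic\<close>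

context perfectly_homogeneous
begin

text \<open>The constant in \<open>dominates\<close> must be at least 1. Enlarging a constant to
  \<open>max 1 C\<close> is harmless because \<open>N\<close> is nonnegative on finitely supported
  sequences.\<close>

lemma dominates_basis_iff:
  assumes "banach_over s"
  shows "dominates N seq_scale canonical_basis norm s y \<longleftrightarrow>
    (\<exists>C>0. \<forall>a. finsupp a \<longrightarrow> norm (lincomb s a y) \<le> C * N a)"
proof
  assume "dominates N seq_scale canonical_basis norm s y"
  then obtain C where "C \<ge> 1" "\<forall>a. finsupp a \<longrightarrow>
      norm (lincomb s a y) \<le> C * N (lincomb seq_scale a canonical_basis)"
    unfolding dominates_def lincomb_def by blast
  then show "\<exists>C>0. \<forall>a. finsupp a \<longrightarrow> norm (lincomb s a y) \<le> C * N a"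
    by (intro exI[of _ C]) (auto simp: lincomb_canonical_basis)
next
  assume "\<exists>C>0. \<forall>a. finsupp a \<longrightarrow> norm (lincomb s a y) \<le> C * N a"
  then obtain C where C: "\<And>a. finsupp a \<Longrightarrow> norm (lincomb s a y) \<le> C * N a" by auto
  have "norm (lincomb s a y) \<le> max 1 C * N (lincomb seq_scale a canonical_basis)" if "finsupp a" for a
    using C[OF that] mult_right_mono[OF max.cobounded2[of C 1] nonneg[OF that]]
    by (simp add: lincomb_canonical_basis[OF that])
  then show "dominates N seq_scale canonical_basis norm s y"
    unfolding dominates_def lincomb_def[symmetric] by (intro exI[of _ "max 1 C"]) auto
qed

lemma basis_dominated_iff:
  assumes "banach_over s"
  shows "dominates norm s y N seq_scale canonical_basis \<longleftrightarrow>
    (\<exists>C>0. \<forall>a. finsupp a \<longrightarrow> N a \<le> C * norm (lincomb s a y))"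
proof
  assume "dominates norm s y N seq_scale canonical_basis"
  then obtain C where "C \<ge> 1" "\<forall>a. finsupp a \<longrightarrow>
      N (lincomb seq_scale a canonical_basis) \<le> C * norm (lincomb s a y)"
    unfolding dominates_def lincomb_def by blast
  then show "\<exists>C>0. \<forall>a. finsupp a \<longrightarrow> N a \<le> C * norm (lincomb s a y)"
    by (intro exI[of _ C]) (auto simp: lincomb_canonical_basis)
next
  assume "\<exists>C>0. \<forall>a. finsupp a \<longrightarrow> N a \<le> C * norm (lincomb s a y)"
  then obtain C where C: "\<And>a. finsupp a \<Longrightarrow> N a \<le> C * norm (lincomb s a y)" by auto
  have "N (lincomb seq_scale a canonical_basis) \<le> max 1 C * norm (lincomb s a y)" if "finsupp a" for a
    using C[OF that] mult_right_mono[OF max.cobounded2[of C 1] norm_ge_zero[of "lincomb s a y"]]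
    by (simp add: lincomb_canonical_basis[OF that])
  then show "dominates norm s y N seq_scale canonical_basis"
    unfolding dominates_def lincomb_def[symmetric] by (intro exI[of _ "max 1 C"]) auto
qed

text \<open>A coordinate of a partial sum is controlled by \<open>N\<close>, and \<open>N\<close> by
  the norm of the partial sum; then the length tends to infinity. Partial sums of length at least
  \<open>Suc k\<close> are the ones that contain the \<open>k\<close>-th term.\<close>

lemma coeff_bound:
  assumes "banach_over s" and C: "C > 0"
    and lower: "\<And>a. finsupp a \<Longrightarrow> N a \<le> C * norm (lincomb s a y)"
    and sums: "(\<lambda>n. s (d n) (y n)) sums w"
  shows "norm (d k) \<le> C * norm w"
proof -
  interpret banach_over s by fact
  have lim: "(\<lambda>m. C * norm (\<Sum>n<m. s (d n) (y n))) \<longlonglongrightarrow> C * norm w"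
    using sums unfolding sums_def by (intro tendsto_intros)
  have "norm (d k) \<le> C * norm (\<Sum>n<m. s (d n) (y n))" if "m \<ge> Suc k" for m
  proof -
    have fin: "finsupp (\<lambda>n. if n < m then d n else 0)"
      by (rule finite_subset[of _ "{..<m}"]) auto
    show ?thesis
      using coord_le[OF fin, of k] lower[OF fin] that by (simp add: lincomb_restrict)
  qed
  then show ?thesis by (intro LIMSEQ_le_const[OF lim] exI[of _ "Suc k"]) simp
qed

text \<open>Completeness of the scalars is not assumed, but it is inherited from the one-dimensional
  space spanned by a member of a basic sequence.\<close>

lemma complete_scalars:
  assumes "banach_over s" and C: "C > 0"
    and lower: "\<And>a. finsupp a \<Longrightarrow> N a \<le> C * norm (lincomb s a y)"
    and basic: "basic_sequence s y"
    and c: "Cauchy (c :: nat \<Rightarrow> 'k)"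
  shows "convergent c"
proof -
  interpret banach_over s by fact
  interpret L: bounded_linear "\<lambda>t. s t (y 0)" by (rule bounded_linear_scale_left)
  have "Cauchy (\<lambda>j. s (c j) (y 0))" using L.Cauchy[OF c] .
  then obtain v where v: "(\<lambda>j. s (c j) (y 0)) \<longlonglongrightarrow> v" unfolding Cauchy_convergent_iff convergent_def by blast
  have "s (c j) (y 0) \<in> span (range y)" for j
    by (rule span_scale[OF span_base]) simp
  with v have "v \<in> closure (span (range y))"
    unfolding closure_sequential by (intro exI[of _ "\<lambda>j. s (c j) (y 0)"] conjI allI)
  \<comment> \<open>The expansion of \<open>v\<close> supplies the limit \<open>a 0\<close>: the
    difference \<open>s (c j) (y 0) - v\<close> has \<open>c j - a 0\<close> as its coefficient at
    0, and \<open>coeff_bound\<close> applies to it.\<close>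
  then obtain a where a: "(\<lambda>n. s (a n) (y n)) sums v" using basic unfolding basic_sequence_def by blast
  have le: "norm (c j - a 0) \<le> C * norm (s (c j) (y 0) - v)" for j
  proof -
    have "(\<lambda>n. if n = 0 then s (c j) (y n) else 0) sums s (c j) (y 0)"
      by (rule sums_single)
    moreover have "(if n = 0 then s (c j) (y n) else 0) = s (if n = 0 then c j else 0) (y n)" for n
      by simp
    ultimately have "(\<lambda>n. s (if n = 0 then c j else 0) (y n)) sums s (c j) (y 0)" by simp
    from sums_diff[OF this a]
    have "(\<lambda>n. s ((if n = 0 then c j else 0) - a n) (y n)) sums (s (c j) (y 0) - v)"
      by (simp only: scale_left_diff_distrib)
    from coeff_bound[OF assms(1) C lower this, of 0] show ?thesis by simp
  qed
  have "(\<lambda>j. C * norm (s (c j) (y 0) - v)) \<longlonglongrightarrow> 0"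
    using tendsto_mult_right_zero[OF tendsto_norm_zero[OF LIM_zero[OF v]], of C] .
  then have "(\<lambda>j. c j - a 0) \<longlonglongrightarrow> 0"
    by (rule Lim_null_comparison[OF always_eventually[OF allI[OF le]]])
  then have "c \<longlonglongrightarrow> a 0" by (rule LIM_zero_cancel)
  then show ?thesis by (auto simp: convergent_def)
qed

text \<open>Vectors of the span that converge to \<open>v\<close> have coefficients that are Cauchy
  in \<open>N\<close>, hence in each coordinate, and the coordinatewise limits expand
  \<open>v\<close>. Uniqueness is \<open>coeff_bound\<close> applied to the difference of two
  expansions of the same vector.\<close>

lemma equivalent_imp_basic:
  assumes "banach_over s" and C: "C > 0"
    and complete: "\<And>c :: nat \<Rightarrow> 'k. Cauchy c \<Longrightarrow> convergent c"
    and upper: "\<And>a. finsupp a \<Longrightarrow> norm (lincomb s a y) \<le> C * N a"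
    and lower: "\<And>a. finsupp a \<Longrightarrow> N a \<le> C * norm (lincomb s a y)"
  shows "basic_sequence s y"
  unfolding basic_sequence_def
proof (intro ballI ex_ex1I)
  interpret banach_over s by fact
  fix v assume "v \<in> closure (span (range y))"
  then obtain w where w: "\<And>j. w j \<in> span (range y)" and wv: "w \<longlonglongrightarrow> v"
    unfolding closure_sequential by blast
  have "\<forall>j. \<exists>b. finsupp b \<and> w j = lincomb s b y" using span_range_imp_lincomb w by blast
  then obtain b where b: "\<And>j. finsupp (b j)" and wb: "\<And>j. w j = lincomb s (b j) y" by metis
  have cauchy: "Cauchy w" using wv by (rule LIMSEQ_imp_Cauchy)
  have diff: "N (\<lambda>n. b i n - b j n) \<le> C * norm (w i - w j)" for i j
    using lower[OF finsupp_diff[OF b b]] by (simp add: lincomb_diff[OF b b] wb)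
  have "Cauchy (\<lambda>j. b j k)" for k
  proof (rule metric_CauchyI)
    fix e :: real assume e: "e > 0"
    then obtain M where M: "\<And>i j. i \<ge> M \<Longrightarrow> j \<ge> M \<Longrightarrow> dist (w i) (w j) < e / C"
      using metric_CauchyD[OF cauchy, of "e / C"] C by (auto simp: zero_less_divide_iff)
    have "dist (b i k) (b j k) < e" if "i \<ge> M" "j \<ge> M" for i j
    proof -
      have "dist (b i k) (b j k) \<le> C * norm (w i - w j)"
        using order_trans[OF coord_le[OF finsupp_diff[OF b b]] diff, of i k j] by (simp add: dist_norm)
      also have "\<dots> < e" using M[OF that] C by (simp add: dist_norm field_simps)
      finally show ?thesis .
    qed
    then show "\<exists>M. \<forall>m\<ge>M. \<forall>n\<ge>M. dist (b m k) (b n k) < e" by blast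
  qed
  then have "\<forall>k. \<exists>l. (\<lambda>j. b j k) \<longlonglongrightarrow> l" using complete unfolding convergent_def by blast
  then obtain \<beta> where \<beta>: "\<And>k. (\<lambda>j. b j k) \<longlonglongrightarrow> \<beta> k" by metis
  have "(\<lambda>n. s (\<beta> n) (y n)) sums v"
    unfolding sums_def
  proof (rule LIMSEQ_I)
    fix e :: real assume e: "e > 0"
    \<comment> \<open>The factor \<open>C * C\<close> is the cost of passing from vectors to
      coefficients and back, and 1 accounts for the distance from \<open>w M\<close> to
      \<open>v\<close>. The choice of \<open>\<delta>\<close> makes the total
      \<open>e / 2\<close>.\<close>
    define q where "q = C * C + 1"
    have q: "q > 0" by (simp add: q_def add_nonneg_pos)
    define \<delta> where "\<delta> = e / (2 * q)"
    have \<delta>: "\<delta> > 0" using e q by (simp add: \<delta>_def)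
    obtain M where M: "\<And>i j. i \<ge> M \<Longrightarrow> j \<ge> M \<Longrightarrow> dist (w i) (w j) < \<delta>"
      using metric_CauchyD[OF cauchy \<delta>] by blast
    have "(\<lambda>i. norm (w i - w M)) \<longlonglongrightarrow> norm (v - w M)" by (intro tendsto_intros wv)
    then have vM: "norm (v - w M) \<le> \<delta>"
      using M[of _ M] by (intro LIMSEQ_le_const2[where X = "\<lambda>i. norm (w i - w M)"]) (auto simp: dist_norm intro!: exI[of _ M] less_imp_le)
    \<comment> \<open>From \<open>m\<close> on, every partial sum of the expansion of
      \<open>w M\<close> is \<open>w M\<close> itself, so only the difference of coefficients
      remains to be estimated.\<close>
    obtain m where m: "{n. b M n \<noteq> 0} \<subseteq> {..<m}"
      using b[of M] finite_nat_bounded by blast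
    have "norm ((\<Sum>n<l. s (\<beta> n) (y n)) - v) < e" if l: "l \<ge> m" for l
    proof -
      have supp: "{n. b M n \<noteq> 0} \<subseteq> {..<l}" using m l by force
      have wM: "w M = (\<Sum>n<l. s (b M n) (y n))"
        unfolding wb by (rule lincomb_eq_sum) (use supp in auto)
      have tend: "(\<lambda>i. norm (\<Sum>n<l. s (b i n - b M n) (y n))) \<longlonglongrightarrow> norm (\<Sum>n<l. s (\<beta> n - b M n) (y n))"
        by (intro tendsto_norm tendsto_sum bounded_linear.tendsto[OF bounded_linear_scale_left]
            tendsto_diff \<beta> tendsto_const)
      have "norm (\<Sum>n<l. s (b i n - b M n) (y n)) \<le> C * (C * \<delta>)" if "i \<ge> M" for i
      proof -
        \<comment> \<open>Cutting a sequence off at \<open>l\<close> does not increase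
          \<open>N\<close>, by \<open>mono\<close>; hence the bound below does not depend on
          \<open>l\<close>.\<close>
        let ?d = "\<lambda>n. if n < l then b i n - b M n else 0"
        have fin: "finsupp ?d" by (rule finite_subset[of _ "{..<l}"]) auto
        have "norm (\<Sum>n<l. s (b i n - b M n) (y n)) \<le> C * N ?d"
          using upper[OF fin] by (simp add: lincomb_restrict)
        also have "\<dots> \<le> C * N (\<lambda>n. b i n - b M n)"
          using C by (intro mult_left_mono mono finsupp_diff b) auto
        also have "\<dots> \<le> C * (C * norm (w i - w M))"
          using C by (intro mult_left_mono diff) auto
        also have "\<dots> \<le> C * (C * \<delta>)"
          using C M[OF that order_refl] by (intro mult_left_mono) (auto simp: dist_norm)
        finally show ?thesis .
      qed
      then have le: "norm (\<Sum>n<l. s (\<beta> n - b M n) (y n)) \<le> C * (C * \<delta>)"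
        by (intro LIMSEQ_le_const2[OF tend]) blast
      have "(\<Sum>n<l. s (\<beta> n) (y n)) - v = (\<Sum>n<l. s (\<beta> n - b M n) (y n)) - (v - w M)"
        by (simp add: wM scale_left_diff_distrib sum_subtractf)
      also have "norm \<dots> \<le> C * (C * \<delta>) + \<delta>"
        by (rule order_trans[OF norm_triangle_ineq4 add_mono[OF le vM]])
      also have "C * (C * \<delta>) + \<delta> = q * \<delta>" by (simp add: q_def algebra_simps)
      also have "\<dots> < e" using q e by (simp add: \<delta>_def)
      finally show ?thesis .
    qed
    then show "\<exists>no. \<forall>n\<ge>no. norm ((\<Sum>n<n. s (\<beta> n) (y n)) - v) < e" by blast
  qed
  then show "\<exists>a. (\<lambda>n. s (a n) (y n)) sums v" by blast
next
  interpret banach_over s by fact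
  fix v a a'
  assume "(\<lambda>n. s (a n) (y n)) sums v" "(\<lambda>n. s (a' n) (y n)) sums v"
  from sums_diff[OF this] have "(\<lambda>n. s (a n - a' n) (y n)) sums 0"
    by (simp add: scale_left_diff_distrib)
  from coeff_bound[OF assms(1) C lower this] show "a = a'" by auto
qed

section \<open>Operators fixing a copy of the basis\<close>

text \<open>The two estimates suffice for operators in \<open>bounded_ops\<close>: boundedness of
  \<open>T\<close> adds the lower one for \<open>x\<close> and the upper one for its image. Applying
  \<open>T\<close> to the whole combination avoids the scalar multiplication of the
  codomain.\<close>

definition fixes_basis ::
  "('k \<Rightarrow> 'x::banach \<Rightarrow> 'x) \<Rightarrow> ('x \<Rightarrow>\<^sub>L 'y::banach) \<Rightarrow> bool" where
  "fixes_basis s T \<longleftrightarrow> (\<exists>x C. C > 0 \<and> (\<forall>a. finsupp a \<longrightarrow>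
     norm (lincomb s a x) \<le> C * N a \<and> N a \<le> C * norm (blinfun_apply T (lincomb s a x))))"

text \<open>The two constants may differ and need not be positive; both are replaced by their
  maximum with 1.\<close>

lemma fixes_basisI:
  assumes "\<And>a. finsupp a \<Longrightarrow> norm (lincomb s a x) \<le> C * N a"
    and "\<And>a. finsupp a \<Longrightarrow> N a \<le> D * norm (blinfun_apply T (lincomb s a x))"
  shows "fixes_basis s T"
proof -
  define E where "E = max 1 (max C D)"
  have "norm (lincomb s a x) \<le> E * N a \<and> N a \<le> E * norm (blinfun_apply T (lincomb s a x))"
    if a: "finsupp a" for a
  proof -
    have E: "C \<le> E" "D \<le> E" by (auto simp: E_def)
    show ?thesis
      using order_trans[OF assms(1)[OF a] mult_right_mono[OF E(1) nonneg[OF a]]]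
        order_trans[OF assms(2)[OF a] mult_right_mono[OF E(2) norm_ge_zero]] by blast
  qed
  moreover have "E > 0" by (simp add: E_def)
  ultimately show ?thesis unfolding fixes_basis_def by blast
qed

text \<open>The second conclusion is recorded because the converse needs complete scalars. It comes
  from the basic sequence that witnesses the failure, through
  \<open>complete_scalars\<close>.\<close>

lemma not_in_JS_imp_fixes_basis:
  assumes X: "banach_over sX" and Y: "banach_over sY"
    and T: "T \<in> bounded_ops sX sY" "T \<notin> JS N seq_scale canonical_basis sX sY"
  shows "fixes_basis sX T" and "Cauchy (c :: nat \<Rightarrow> 'k) \<Longrightarrow> convergent c"
proof -
  obtain x where basic: "basic_sequence sX x"
    and upper: "dominates N seq_scale canonical_basis norm sX x"
    and lower: "dominates norm sY (\<lambda>n. blinfun_apply T (x n)) N seq_scale canonical_basis"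
    using T unfolding JS_def by blast
  obtain C where C: "\<forall>a. finsupp a \<longrightarrow> norm (lincomb sX a x) \<le> C * N a"
    using upper unfolding dominates_basis_iff[OF X] by blast
  obtain D where D: "D > 0" "\<forall>a. finsupp a \<longrightarrow> N a \<le> D * norm (blinfun_apply T (lincomb sX a x))"
    using lower unfolding basis_dominated_iff[OF Y] bounded_ops_lincomb[OF T(1), symmetric] by blast
  show "fixes_basis sX T"
    by (rule fixes_basisI[where x = x and C = C and D = D]) (use C D(2) in simp_all)
  have D': "D * (norm T + 1) > 0" using D(1) by (simp add: add_nonneg_pos)
  have lowerX: "N a \<le> D * (norm T + 1) * norm (lincomb sX a x)" if a: "finsupp a" for a
    by (rule bounded_below_of_image[OF D(1)]) (use D(2) a in blast)
  show "convergent c" if "Cauchy c"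
    by (rule complete_scalars[OF X D' lowerX basic that])
qed

text \<open>The vectors \<open>x n\<close> are divided by their norms. The result \<open>y\<close>
  is still equivalent to the basis, so \<open>equivalent_imp_basic\<close> makes it basic; this is
  where completeness of the scalars enters.\<close>

lemma fixes_basis_imp_not_in_JS:
  assumes X: "banach_over sX" and Y: "banach_over sY" and T: "T \<in> bounded_ops sX sY"
    and complete: "\<And>c :: nat \<Rightarrow> 'k. Cauchy c \<Longrightarrow> convergent c"
    and "fixes_basis sX T"
  shows "T \<notin> JS N seq_scale canonical_basis sX sY"
proof -
  interpret X: banach_over sX by fact
  obtain x C where C: "C > 0"
    and bounds: "\<forall>a. finsupp a \<longrightarrow> norm (lincomb sX a x) \<le> C * N a \<and>
      N a \<le> C * norm (blinfun_apply T (lincomb sX a x))"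
    using assms(5) unfolding fixes_basis_def by blast
  have upper: "norm (lincomb sX a x) \<le> C * N a"
    and lower: "N a \<le> C * norm (blinfun_apply T (lincomb sX a x))"
    if "finsupp a" for a
    using bounds that by blast+
  define M where "M = C * (norm T + 1)"
  have M: "M > 0" using C by (simp add: M_def add_nonneg_pos)
  have lowerX: "N a \<le> M * norm (lincomb sX a x)" if a: "finsupp a" for a
    unfolding M_def by (rule bounded_below_of_image[OF C lower[OF a]])
  have single: "finsupp (canonical_basis n :: nat \<Rightarrow> 'k)" "lincomb sX (canonical_basis n) x = x n" for n
  proof -
    show "finsupp (canonical_basis n :: nat \<Rightarrow> 'k)"
      by (rule finite_subset[of _ "{n}"]) (auto simp: canonical_basis_def)
    show "lincomb sX (canonical_basis n) x = x n"
      using X.lincomb_single[of n 1 x] by (simp add: canonical_basis_def[abs_def])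
  qed
  \<comment> \<open>Testing both estimates on unit vectors places the norms of all
    \<open>x n\<close> between \<open>1 / M\<close> and \<open>C\<close>.\<close>
  have x_upper: "norm (x n) \<le> C" and x_lower: "1 \<le> M * norm (x n)" for n
    using upper[OF single(1)[of n]] lowerX[OF single(1)[of n]] by (simp_all add: single(2) basis)
  have x_pos: "norm (x n) > 0" for n using x_lower[of n] by (cases "x n = 0") auto
  define y where "y n = sX (of_real (1 / norm (x n))) (x n)" for n
  have lin_y: "lincomb sX a y = lincomb sX (\<lambda>n. of_real (1 / norm (x n)) * a n) x" if "finsupp a" for a
  proof -
    have "lincomb sX (\<lambda>n. of_real (1 / norm (x n)) * a n) x = (\<Sum>n | a n \<noteq> 0. sX (of_real (1 / norm (x n)) * a n) (x n))"
      by (rule X.lincomb_eq_sum) (use that in auto)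
    also have "\<dots> = lincomb sX a y" by (simp add: lincomb_def y_def mult.commute)
    finally show ?thesis ..
  qed
  have norm_y: "norm (y n) = 1" for n
    using x_pos[of n] by (simp add: y_def X.norm_scale norm_divide del: of_real_divide)
  \<comment> \<open>By unconditionality in the form of \<open>mono\<close>, the rescaling of
    coefficients costs at most a factor \<open>M\<close> in one direction and \<open>C\<close> in
    the other.\<close>
  have resc: "N (\<lambda>n. of_real (1 / norm (x n)) * a n) \<le> M * N a"
             "N a \<le> C * N (\<lambda>n. of_real (1 / norm (x n)) * a n)" if a: "finsupp a" for a :: "nat \<Rightarrow> 'k"
  proof -
    have "N (\<lambda>n. of_real (1 / norm (x n)) * a n) \<le> N (\<lambda>n. of_real M * a n)"
    proof (rule mono[OF finsupp_mult[OF a]])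
      fix n
      have "1 / norm (x n) \<le> M" using x_lower[of n] x_pos[of n] by (simp add: field_simps)
      then show "norm (of_real (1 / norm (x n)) * a n) \<le> norm (of_real M * a n)"
        using M unfolding norm_mult norm_of_real by (intro mult_right_mono) auto
    qed
    also have "\<dots> = M * N a" using mult[OF a] M by simp
    finally show "N (\<lambda>n. of_real (1 / norm (x n)) * a n) \<le> M * N a" .
    have "N a \<le> N (\<lambda>n. of_real C * (of_real (1 / norm (x n)) * a n))"
    proof (intro mono finsupp_mult a)
      fix n
      have "1 \<le> C * (1 / norm (x n))" using x_upper[of n] x_pos[of n] by (simp add: field_simps)
      from mult_right_mono[OF this norm_ge_zero[of "a n"]]
      show "norm (a n) \<le> norm (of_real C * (of_real (1 / norm (x n)) * a n))"
        using C unfolding norm_mult norm_of_real by (simp add: mult.assoc)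
    qed
    also have "\<dots> = C * N (\<lambda>n. of_real (1 / norm (x n)) * a n)" using C by (subst mult[OF finsupp_mult[OF a]]) simp
    finally show "N a \<le> C * N (\<lambda>n. of_real (1 / norm (x n)) * a n)" .
  qed
  have upper_y: "norm (lincomb sX a y) \<le> (C * M) * N a" if a: "finsupp a" for a
    using order_trans[OF upper[OF finsupp_mult[OF a]] mult_left_mono[OF resc(1)[OF a]]] C
    by (simp add: lin_y[OF a] mult.assoc)
  have lower_y: "N a \<le> (C * C) * norm (blinfun_apply T (lincomb sX a y))" if a: "finsupp a" for a
    using order_trans[OF resc(2)[OF a] mult_left_mono[OF lower[OF finsupp_mult[OF a]]]] C
    by (simp add: lin_y[OF a] mult.assoc)
  have lower_yX: "N a \<le> (C * M) * norm (lincomb sX a y)" if a: "finsupp a" for a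
    using order_trans[OF resc(2)[OF a] mult_left_mono[OF lowerX[OF finsupp_mult[OF a]]]] C
    by (simp add: lin_y[OF a] mult.assoc)
  have CM: "C * M > 0" "C * C > 0" using C M by auto
  have "basic_sequence sX y"
    by (rule equivalent_imp_basic[OF X CM(1) complete upper_y lower_yX])
  moreover have "dominates N seq_scale canonical_basis norm sX y"
    unfolding dominates_basis_iff[OF X] using upper_y CM by blast
  moreover have "dominates norm sY (\<lambda>n. blinfun_apply T (y n)) N seq_scale canonical_basis"
    unfolding basis_dominated_iff[OF Y] using lower_y CM by (auto simp: bounded_ops_lincomb[OF T])
  ultimately show ?thesis using norm_y by (auto simp: JS_def)
qed

section \<open>Composition, sums, finite rank and perturbation\<close>

text \<open>The operator \<open>A\<close> carries the fixed copy into the domain of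
  \<open>T\<close>: its norm enters the upper estimate, and the norm of \<open>B\<close> the lower
  one.\<close>

lemma fixes_basis_compose:
  assumes "A \<in> bounded_ops sW sX" "fixes_basis sW (B o\<^sub>L T o\<^sub>L A)"
  shows "fixes_basis sX T"
proof -
  obtain x C where C: "C > 0"
    and bounds: "\<forall>a. finsupp a \<longrightarrow> norm (lincomb sW a x) \<le> C * N a \<and>
      N a \<le> C * norm (blinfun_apply (B o\<^sub>L T o\<^sub>L A) (lincomb sW a x))"
    using assms(2) unfolding fixes_basis_def by blast
  have upper: "norm (lincomb sW a x) \<le> C * N a"
    and lower: "N a \<le> C * norm (blinfun_apply (B o\<^sub>L T o\<^sub>L A) (lincomb sW a x))"
    if "finsupp a" for a
    using bounds that by blast+
  show ?thesis
  proof (rule fixes_basisI[where x = "\<lambda>n. blinfun_apply A (x n)" and C = "norm A * C" and D = "C * norm B"])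
    fix a :: "nat \<Rightarrow> 'k" assume a: "finsupp a"
    let ?v = "lincomb sW a x"
    have eq: "lincomb sX a (\<lambda>n. blinfun_apply A (x n)) = blinfun_apply A ?v"
      by (rule bounded_ops_lincomb[OF assms(1), symmetric])
    have "norm (blinfun_apply A ?v) \<le> norm A * (C * N a)"
      by (rule order_trans[OF norm_blinfun mult_left_mono[OF upper[OF a] norm_ge_zero]])
    then show "norm (lincomb sX a (\<lambda>n. blinfun_apply A (x n))) \<le> norm A * C * N a"
      by (simp only: eq mult.assoc)
    have "N a \<le> C * norm (blinfun_apply B (blinfun_apply T (blinfun_apply A ?v)))"
      using lower[OF a] by (simp only: blinfun_apply_blinfun_compose)
    also have "\<dots> \<le> C * (norm B * norm (blinfun_apply T (blinfun_apply A ?v)))"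
      using C by (intro mult_left_mono norm_blinfun) simp
    finally show "N a \<le> C * norm B * norm (blinfun_apply T (lincomb sX a (\<lambda>n. blinfun_apply A (x n))))"
      by (simp only: eq mult.assoc)
  qed
qed

lemma fixes_basis_add:
  assumes X: "banach_over sX" and Y: "banach_over sY"
    and S: "S \<in> bounded_ops sX sY"
    and ST: "fixes_basis sX (S + T)"
  shows "fixes_basis sX S \<or> fixes_basis sX T"
proof -
  interpret X: banach_over sX by fact
  interpret Y: banach_over sY by fact
  obtain x C where C: "C > 0"
    and bounds: "\<forall>a. finsupp a \<longrightarrow> norm (lincomb sX a x) \<le> C * N a \<and>
      N a \<le> C * norm (blinfun_apply (S + T) (lincomb sX a x))"
    using ST unfolding fixes_basis_def by blast
  have upper: "norm (lincomb sX a x) \<le> C * N a"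
    and lower: "N a \<le> C * norm (blinfun_apply (S + T) (lincomb sX a x))"
    if "finsupp a" for a
    using bounds that by blast+
  show ?thesis
  proof (cases "\<exists>m D. \<forall>a. finsupp a \<longrightarrow> (\<forall>n<m. a n = 0) \<longrightarrow> N a \<le> D * norm (blinfun_apply S (lincomb sX a x))")
    case True
    then obtain m D where D: "\<And>a. finsupp a \<Longrightarrow> (\<And>n. n < m \<Longrightarrow> a n = 0) \<Longrightarrow>
        N a \<le> D * norm (blinfun_apply S (lincomb sX a x))" by blast
    \<comment> \<open>The unit vectors from \<open>m\<close> on are themselves disjoint blocks of
      norm 1, so \<open>disjoint\<close> shows that shifting coefficients by \<open>m\<close>
      preserves \<open>N\<close>.\<close>
    define c where "c k = (canonical_basis (k + m) :: nat \<Rightarrow> 'k)" for k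
    have c: "finsupp (c k)" for k
      by (rule finite_subset[of _ "{k + m}"]) (auto simp: canonical_basis_def c_def)
    define sh where "sh a = (\<lambda>n. \<Sum>k | a k \<noteq> 0. a k * c k n)" for a :: "nat \<Rightarrow> 'k"
    have sh: "finsupp (sh a)" "N (sh a) = N a" "\<And>n. n < m \<Longrightarrow> sh a n = 0" 
      "lincomb sX a (\<lambda>k. lincomb sX (c k) x) = lincomb sX (sh a) x" if a: "finsupp a" for a
    proof -
      show "finsupp (sh a)" unfolding sh_def by (rule finsupp_block[OF a c])
      show "N (sh a) = N a" unfolding sh_def
      proof (rule disjoint[OF a c])
        show "N (c k) = 1" for k by (simp add: c_def basis)
        show "j = k" if "c j n \<noteq> 0" "c k n \<noteq> 0" for j k n
          using that by (auto simp: c_def canonical_basis_def split: if_splits)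
      qed
      show "sh a n = 0" if "n < m" for n
        unfolding sh_def by (rule sum.neutral) (use that in \<open>auto simp: c_def canonical_basis_def\<close>)
      show "lincomb sX a (\<lambda>k. lincomb sX (c k) x) = lincomb sX (sh a) x"
        unfolding sh_def by (rule X.lincomb_lincomb[OF a c])
    qed
    have "fixes_basis sX S"
    proof (rule fixes_basisI[where x = "\<lambda>k. lincomb sX (c k) x" and C = C and D = D])
      fix a :: "nat \<Rightarrow> 'k" assume a: "finsupp a"
      show "norm (lincomb sX a (\<lambda>k. lincomb sX (c k) x)) \<le> C * N a"
        using upper[OF sh(1)[OF a]] by (simp add: sh[OF a])
      show "N a \<le> D * norm (blinfun_apply S (lincomb sX a (\<lambda>k. lincomb sX (c k) x)))"
        using D[OF sh(1)[OF a] sh(3)[OF a]] by (simp add: sh[OF a])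
    qed
    then show ?thesis ..
  next
    case False
    have small: "\<exists>a. finsupp a \<and> (\<forall>n<m. a n = 0) \<and> N a = 1 \<and> norm (blinfun_apply S (lincomb sX a x)) \<le> \<delta>"
      if \<delta>: "\<delta> > 0" for m \<delta>
    proof -
      \<comment> \<open>The failed lower bound is used with constant \<open>1 / \<delta>\<close>;
        dividing the resulting \<open>a\<close> by \<open>N a\<close> gives the small
        vector.\<close>
      have "\<not> (\<forall>a. finsupp a \<longrightarrow> (\<forall>n<m. a n = 0) \<longrightarrow>
          N a \<le> (1 / \<delta>) * norm (blinfun_apply S (lincomb sX a x)))" using False by blast
      then obtain a where a: "finsupp a" "\<And>n. n < m \<Longrightarrow> a n = 0" 
        "(1 / \<delta>) * norm (blinfun_apply S (lincomb sX a x)) < N a"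
        unfolding not_all not_imp not_le by blast
      have pos: "N a > 0" by (rule le_less_trans[OF _ a(3)]) (use \<delta> in simp)
      define a' where "a' n = of_real (1 / N a) * a n" for n
      have "lincomb sX a' x = sX (of_real (1 / N a)) (lincomb sX a x)"
        unfolding a'_def[abs_def] by (rule X.lincomb_mult[OF a(1)])
      then have lin: "blinfun_apply S (lincomb sX a' x) = sY (of_real (1 / N a)) (blinfun_apply S (lincomb sX a x))"
        using S unfolding bounded_ops_def by simp
      have "N a' = 1" unfolding a'_def[abs_def] mult[OF a(1)] using pos by (simp add: norm_divide)
      moreover have "norm (blinfun_apply S (lincomb sX a' x)) \<le> \<delta>"
        using a(3) pos \<delta> unfolding lin Y.norm_scale norm_of_real by (simp add: field_simps)
      moreover have "finsupp a'" unfolding a'_def[abs_def] by (rule finsupp_mult[OF a(1)])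
      moreover have "\<forall>n<m. a' n = 0" using a(2) by (simp add: a'_def)
      ultimately show ?thesis by blast
    qed
    \<comment> \<open>Since the powers of \<open>1 / 2\<close> sum to 2, the images of the blocks
      under \<open>S\<close> contribute at most \<open>2 * \<delta> = 1 / (2 * C)\<close> times
      \<open>N a\<close>, half of what the lower estimate for \<open>S + T\<close>
      guarantees.\<close>
    define \<delta> where "\<delta> = 1 / (4 * C)"
    have \<delta>: "\<delta> > 0" using C by (simp add: \<delta>_def)
    have "\<exists>a. finsupp a \<and> (\<forall>n<m. a n = 0) \<and>
        (N a = 1 \<and> norm (blinfun_apply S (lincomb sX a x)) \<le> \<delta> * (1 / 2) ^ k)" for m k
      by (rule small) (use \<delta> in simp)
    from disjoint_blocks[where Q = "\<lambda>k a. N a = 1 \<and> norm (blinfun_apply S (lincomb sX a x)) \<le> \<delta> * (1 / 2) ^ k", OF this]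
    obtain c where c0: "\<forall>k. finsupp (c k) \<and>
          N (c k) = 1 \<and> norm (blinfun_apply S (lincomb sX (c k) x)) \<le> \<delta> * (1 / 2) ^ k"
        and dis0: "\<forall>j k n. c j n \<noteq> 0 \<longrightarrow> c k n \<noteq> 0 \<longrightarrow> j = k"
      by blast
    have c: "finsupp (c k)" "N (c k) = 1" "norm (blinfun_apply S (lincomb sX (c k) x)) \<le> \<delta> * (1 / 2) ^ k" for k
      using c0 by blast+
    have dis: "j = k" if "c j n \<noteq> 0" "c k n \<noteq> 0" for j k n
      using dis0 that by blast
    define u where "u k = lincomb sX (c k) x" for k
    define bl where "bl a = (\<lambda>n. \<Sum>k | a k \<noteq> 0. a k * c k n)" for a :: "nat \<Rightarrow> 'k"
    have bl: "finsupp (bl a)" "N (bl a) = N a" "lincomb sX a u = lincomb sX (bl a) x" if a: "finsupp a" for a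
    proof -
      show "finsupp (bl a)" unfolding bl_def by (rule finsupp_block[OF a c(1)])
      show "N (bl a) = N a" unfolding bl_def by (rule disjoint[OF a c(1,2) dis])
      show "lincomb sX a u = lincomb sX (bl a) x"
        unfolding bl_def u_def by (rule X.lincomb_lincomb[OF a c(1)])
    qed
    have "fixes_basis sX T"
    proof (rule fixes_basisI[where x = u and C = C and D = "2 * C"])
      fix a :: "nat \<Rightarrow> 'k" assume a: "finsupp a"
      show "norm (lincomb sX a u) \<le> C * N a"
        using upper[OF bl(1)[OF a]] by (simp add: bl[OF a])
      have "norm (blinfun_apply S (lincomb sX a u)) \<le> (\<Sum>k | a k \<noteq> 0. norm (sY (a k) (blinfun_apply S (u k))))"
        unfolding bounded_ops_lincomb[OF S] unfolding lincomb_def by (rule norm_sum)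
      also have "\<dots> \<le> (\<Sum>k | a k \<noteq> 0. N a * (\<delta> * (1 / 2) ^ k))"
        unfolding Y.norm_scale u_def using nonneg[OF a] c(3) coord_le[OF a] by (intro sum_mono mult_mono) auto
      also have "\<dots> = N a * \<delta> * (\<Sum>k | a k \<noteq> 0. (1 / 2) ^ k)" by (simp add: sum_distrib_left mult.assoc)
      also have "\<dots> \<le> N a * \<delta> * 2"
      proof (rule mult_left_mono)
        have "(\<Sum>k | a k \<noteq> 0. (1 / 2 :: real) ^ k) \<le> (\<Sum>k. (1 / 2) ^ k)"
          by (rule sum_le_suminf) (use a in auto)
        then show "(\<Sum>k | a k \<noteq> 0. (1 / 2 :: real) ^ k) \<le> 2" by (simp add: suminf_geometric)
      qed (use nonneg[OF a] \<delta> in auto)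
      finally have Sle: "C * norm (blinfun_apply S (lincomb sX a u)) \<le> N a / 2"
        using C by (simp add: \<delta>_def field_simps)
      have "N a \<le> C * norm (blinfun_apply (S + T) (lincomb sX a u))"
        using lower[OF bl(1)[OF a]] by (simp add: bl[OF a])
      also have "\<dots> \<le> C * (norm (blinfun_apply S (lincomb sX a u)) + norm (blinfun_apply T (lincomb sX a u)))"
        using C by (intro mult_left_mono) (auto simp: blinfun.add_left norm_triangle_ineq)
      finally show "N a \<le> 2 * C * norm (blinfun_apply T (lincomb sX a u))"
        using Sle by (simp add: algebra_simps)
    qed
    then show ?thesis ..
  qed
qed

lemma fixes_basis_op_scale:
  assumes "banach_over sY" "fixes_basis sX (op_scale sY c T)"
  shows "fixes_basis sX T"
proof -
  interpret banach_over sY by fact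
  obtain x C where bounds: "\<forall>a. finsupp a \<longrightarrow> norm (lincomb sX a x) \<le> C * N a \<and>
      N a \<le> C * norm (blinfun_apply (op_scale sY c T) (lincomb sX a x))"
    using assms(2) unfolding fixes_basis_def by blast
  show ?thesis
    \<comment> \<open>For \<open>c = 0\<close> the constant \<open>D\<close> is zero, which
      \<open>fixes_basisI\<close> accepts, so no case distinction is made.\<close>
    by (rule fixes_basisI[where x = x and C = C and D = "C * norm c"])
      (use bounds in \<open>simp_all add: op_scale_apply norm_scale mult.assoc\<close>)
qed

text \<open>The lower estimate forces the coefficients of any vanishing combination of the image
  vectors to be zero. A finite-rank operator would thus have an infinite independent set in a
  finitely spanned range.\<close>

lemma finite_rank_not_fixes_basis:
  assumes Y: "banach_over sY" and T: "T \<in> bounded_ops sX sY" and "finite_rank sY T"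
  shows "\<not> fixes_basis sX T"
proof
  interpret banach_over sY by fact
  assume "fixes_basis sX T"
  then obtain x C where C: "\<And>a. finsupp a \<Longrightarrow> N a \<le> C * norm (lincomb sY a (\<lambda>n. blinfun_apply T (x n)))"
    unfolding fixes_basis_def bounded_ops_lincomb[OF T] by blast
  define z where "z n = blinfun_apply T (x n)" for n
  have zero: "a n = 0" if "finsupp a" "lincomb sY a z = 0" for a n
  proof -
    have "N a \<le> 0" using C[OF that(1)] that(2) by (simp add: z_def[abs_def])
    then have "norm (a n) \<le> 0" by (rule order_trans[OF coord_le[OF that(1)]])
    then show ?thesis by simp
  qed
  \<comment> \<open>Independence concerns the set \<open>range z\<close>; injectivity makes that set
    infinite and lets coefficients on vectors be pulled back to coefficients on indices.\<close>
  have inj: "inj z"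
  proof (rule injI, rule ccontr)
    fix i j assume ij: "z i = z j" "i \<noteq> j"
    let ?a = "\<lambda>n. (if n = i then 1 else 0) - (if n = j then 1 else 0 :: 'k)"
    have 1: "finsupp (\<lambda>n. if n = k then 1 else 0 :: 'k)" for k
      by (rule finite_subset[of _ "{k}"]) auto
    have "lincomb sY ?a z = 0" unfolding lincomb_diff[OF 1 1] lincomb_single using ij by simp
    from zero[OF finsupp_diff[OF 1 1] this, of i] ij show False by simp
  qed
  have "independent (range z)"
    unfolding independent_explicit_module
  proof (intro allI impI)
    fix t u v
    assume t: "finite t" "t \<subseteq> range z" and sum: "(\<Sum>v\<in>t. sY (u v) v) = 0" and v: "v \<in> t"
    define a where "a n = (if z n \<in> t then u (z n) else 0)" for n
    have F: "finite (z -` t)" using t inj by (intro finite_vimageI) auto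
    have "lincomb sY a z = (\<Sum>n\<in>z -` t. sY (a n) (z n))"
      by (rule lincomb_eq_sum[OF F]) (auto simp: a_def split: if_splits)
    also have "\<dots> = (\<Sum>n\<in>z -` t. sY (u (z n)) (z n))" by (intro sum.cong) (auto simp: a_def)
    also have "\<dots> = (\<Sum>v\<in>z ` (z -` t). sY (u v) v)"
      using inj by (subst sum.reindex) (auto intro: inj_on_subset)
    also have "z ` (z -` t) = t" using t by auto
    finally have "lincomb sY a z = 0" using sum by simp
    moreover have "finsupp a" by (rule finite_subset[OF _ F]) (auto simp: a_def split: if_splits)
    moreover obtain n where "v = z n" using v t by auto
    ultimately show "u v = 0" using zero[of a n] v by (auto simp: a_def)
  qed
  moreover obtain B where "finite B" "range (blinfun_apply T) \<subseteq> span B"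
    using assms(3) by (auto simp: finite_rank_def)
  moreover have "range z \<subseteq> range (blinfun_apply T)" by (auto simp: z_def)
  ultimately have "finite (range z)" using independent_span_bound by (meson order_trans)
  then show False using inj finite_imageD by blast
qed

text \<open>The same \<open>x\<close> works for every nearby operator. Within distance
  \<open>1 / (2 * C * C)\<close> the image of a combination moves by at most
  \<open>N a / (2 * C)\<close>, half of its lower bound, so \<open>C\<close> doubles to
  \<open>2 * C\<close>.\<close>

lemma fixes_basis_open:
  assumes "fixes_basis s T"
  shows "\<exists>e>0. \<forall>T'. dist T' T < e \<longrightarrow> fixes_basis s T'"
proof -
  obtain x C where C: "C > 0"
    and bounds: "\<forall>a. finsupp a \<longrightarrow> norm (lincomb s a x) \<le> C * N a \<and>
      N a \<le> C * norm (blinfun_apply T (lincomb s a x))"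
    using assms unfolding fixes_basis_def by blast
  have upper: "norm (lincomb s a x) \<le> C * N a"
    and lower: "N a \<le> C * norm (blinfun_apply T (lincomb s a x))"
    if "finsupp a" for a
    using bounds that by blast+
  have "fixes_basis s T'" if "dist T' T < 1 / (2 * C * C)" for T'
  proof (rule fixes_basisI[OF upper, where D = "2 * C"])
    fix a :: "nat \<Rightarrow> 'k" assume a: "finsupp a"
    let ?v = "lincomb s a x"
    have "norm (blinfun_apply (T - T') ?v) \<le> norm (T - T') * norm ?v" by (rule norm_blinfun)
    also have "\<dots> \<le> 1 / (2 * C * C) * (C * N a)"
      using that upper[OF a] C by (intro mult_mono) (auto simp: dist_norm norm_minus_commute)
    finally have "C * norm (blinfun_apply (T - T') ?v) \<le> N a / 2" using C by (simp add: field_simps)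
    moreover have "norm (blinfun_apply T ?v) \<le> norm (blinfun_apply T' ?v) + norm (blinfun_apply (T - T') ?v)"
      using norm_triangle_ineq[of "blinfun_apply T' ?v" "blinfun_apply (T - T') ?v"] by (simp add: blinfun.diff_left)
    from mult_left_mono[OF this, of C] 
    have "C * norm (blinfun_apply T ?v) \<le> C * norm (blinfun_apply T' ?v) + C * norm (blinfun_apply (T - T') ?v)"
      using C by (simp add: algebra_simps)
    ultimately show "N a \<le> 2 * C * norm (blinfun_apply T' ?v)" using lower[OF a] by simp
  qed
  then show ?thesis using C by (intro exI[of _ "1 / (2 * C * C)"]) auto
qed

end

section \<open>The ideal properties and closedness\<close>

theorem theorem3p6:
  fixes sW :: "'k::real_normed_field \<Rightarrow> 'w::banach \<Rightarrow> 'w"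
    and sX :: "'k \<Rightarrow> 'x::banach \<Rightarrow> 'x"
    and sY :: "'k \<Rightarrow> 'y::banach \<Rightarrow> 'y"
    and sZ :: "'k \<Rightarrow> 'z::banach \<Rightarrow> 'z"
    and nE :: "(nat \<Rightarrow> 'k) \<Rightarrow> real"
  assumes "banach_over sW" and "banach_over sX" and "banach_over sY" and "banach_over sZ"
    and "(\<exists>p\<ge>1. nE = lp_norm p) \<or> nE = c0_norm"
  shows "(\<forall>A \<in> bounded_ops sW sX. \<forall>T \<in> JS nE seq_scale canonical_basis sX sY.
            \<forall>B \<in> bounded_ops sY sZ.
              B o\<^sub>L T o\<^sub>L A \<in> JS nE seq_scale canonical_basis sW sZ)
       \<and> module.subspace (op_scale sY) (JS nE seq_scale canonical_basis sX sY)
       \<and> (\<forall>T \<in> bounded_ops sX sY. finite_rank sY T \<longrightarrow>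
              T \<in> JS nE seq_scale canonical_basis sX sY)
       \<and> closedin (top_of_set (bounded_ops sX sY)) (JS nE seq_scale canonical_basis sX sY)"
proof -
  interpret perfectly_homogeneous nE
    using assms(5) perfectly_homogeneous_lp_norm perfectly_homogeneous_c0_norm by blast
  interpret X: banach_over sX by fact
  interpret Y: banach_over sY by fact
  let ?JS = "JS nE seq_scale canonical_basis sX sY"
  have ops: "T \<in> bounded_ops sX sY" if "T \<in> ?JS" for T using that by (simp add: JS_def)
  note not_JS = not_in_JS_imp_fixes_basis[OF assms(2,3)]
  \<comment> \<open>Completeness of the scalars is a premise here. Each use obtains it from the
    operator supposed to lie outside its component, by the second conclusion of
    \<open>not_in_JS_imp_fixes_basis\<close>.\<close>
  have JS: "\<not> fixes_basis sX T" if "T \<in> ?JS" "\<And>c :: nat \<Rightarrow> 'k. Cauchy c \<Longrightarrow> convergent c" for T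
    using fixes_basis_imp_not_in_JS[OF assms(2,3) ops[OF that(1)] that(2)] that(1) by blast
  have finite: "T \<in> ?JS" if "T \<in> bounded_ops sX sY" "finite_rank sY T" for T
    using finite_rank_not_fixes_basis[OF assms(3) that] not_JS(1)[OF that(1)] by blast
  have "B o\<^sub>L T o\<^sub>L A \<in> JS nE seq_scale canonical_basis sW sZ"
    if A: "A \<in> bounded_ops sW sX" and T: "T \<in> ?JS" and B: "B \<in> bounded_ops sY sZ" for A T B
  proof (rule ccontr)
    assume *: "B o\<^sub>L T o\<^sub>L A \<notin> JS nE seq_scale canonical_basis sW sZ"
    have "B o\<^sub>L T o\<^sub>L A \<in> bounded_ops sW sZ" using A B ops[OF T] by (simp add: bounded_ops_def)
    note not = not_in_JS_imp_fixes_basis[OF assms(1,4) this *]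
    show False using JS[OF T not(2)] fixes_basis_compose[OF A not(1)] by blast
  qed
  moreover have "module.subspace (op_scale sY) ?JS"
    unfolding module.subspace_def[OF Y.module_op_scale]
  proof (intro conjI ballI allI)
    show "0 \<in> ?JS"
      by (rule finite) (auto simp: bounded_ops_def finite_rank_def intro!: exI[of _ "{}"])
  next
    fix S T assume S: "S \<in> ?JS" and T: "T \<in> ?JS"
    have ST: "S + T \<in> bounded_ops sX sY"
      using ops[OF S] ops[OF T] by (simp add: bounded_ops_def blinfun.add_left Y.scale_right_distrib)
    show "S + T \<in> ?JS"
    proof (rule ccontr)
      assume "S + T \<notin> ?JS"
      note not = not_JS[OF ST this]
      show False
        using fixes_basis_add[OF assms(2,3) ops[OF S] not(1)] JS[OF S not(2)] JS[OF T not(2)] by blast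
    qed
  next
    fix c T assume T: "T \<in> ?JS"
    have cT: "op_scale sY c T \<in> bounded_ops sX sY"
      using ops[OF T] by (simp add: bounded_ops_def Y.op_scale_apply mult.commute)
    show "op_scale sY c T \<in> ?JS"
    proof (rule ccontr)
      assume "op_scale sY c T \<notin> ?JS"
      note not = not_JS[OF cT this]
      show False using fixes_basis_op_scale[OF assms(3) not(1)] JS[OF T not(2)] by blast
    qed
  qed
  moreover have "closedin (top_of_set (bounded_ops sX sY)) ?JS"
    unfolding closedin_def topspace_euclidean_subtopology openin_euclidean_subtopology_iff
  proof (intro conjI ballI)
    fix T assume T: "T \<in> bounded_ops sX sY - ?JS"
    then have T': "T \<in> bounded_ops sX sY" "T \<notin> ?JS" by auto
    note not = not_JS[OF T']
    \<comment> \<open>All operators in a ball around \<open>T\<close> fix the basis, so none of them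
      lies in \<open>?JS\<close>: the complement is relatively open.\<close>
    obtain e where "e > 0" "\<And>T'. dist T' T < e \<Longrightarrow> fixes_basis sX T'"
      using fixes_basis_open[OF not(1)] by blast
    then show "\<exists>e>0. \<forall>T'\<in>bounded_ops sX sY. dist T' T < e \<longrightarrow> T' \<in> bounded_ops sX sY - ?JS"
      using JS not(2) by blast
  qed (use ops in auto)
  ultimately show ?thesis using finite by blast
qed

end
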